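(* Let $J$ be one-homogeneous and let $u_\lambda$ be a singular vector of $J$ with corresponding singular value $\lambda$. If the data are $f=\gamma Ku_\lambda$ for a positive constant $\gamma$, then a solution of the inverse scale space flow $$\partial_tp(t)=K^*(f-Ku(t)),\qquad p(t)\in\partial J(u(t)),\qquad p(0)=0,$$ is given by $$u(t)=\begin{cases}0 & \text{if } t<t_*,\\ \gamma u_\lambda & \text{if } t\ge t_*,\end{cases}\qquad t_*=\frac{\lambda}{\gamma}.$$
   Context: Setting: $\mathcal U$ is a real Banach space that is the dual of some Banach space, $\mathcal H$ is a real Hilbert space, $K:\mathcal U\to\mathcal H$ is a bounded linear operator, and $J:\mathcal U\to\mathbb{R}\cup\{+\infty\}$ is proper, convex and non-negative, with $\mathrm{dom}(J)=\{u: J(u)<\infty\}$ and with non-empty subdifferential at every $u\in\mathrm{dom}(J)$. One-homogeneous means $J(cu)=|c|J(u)$ for all $c\in\mathbb{R}$, $u\in\mathcal U$ (with $0\cdot\infty=0$). $K^*:\mathcal H\to\mathcal U^*$ is the adjoint, $\langle K^*h,u\rangle_{\mathcal U}=\langle h,Ku\rangle_{\mathcal H}$. The subdifferential is $\partial J(u)=\{p\in\mathcal U^* : J(v)-J(u)-\langle p,v-u\rangle_{\mathcal U}\ge 0\ \forall v\in\mathcal U\}$. A singular vector of $J$ with singular value $\lambda$ is an element $u_\lambda\ne0$ with $\|Ku_\lambda\|_{\mathcal H}=1$ and $\lambda K^*Ku_\lambda\in\partial J(u_\lambda)$. That $u:[0,\infty)\to\mathcal U$ is a solution of the inverse scale space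 flow means that there is a continuous $p:[0,\infty)\to\mathcal U^*$ with $p(0)=0$, $p(t)\in\partial J(u(t))$ for all $t\ge0$, and $\partial_tp(t)=K^*(f-Ku(t))$ for all $t>0$ except the jump time of $u$. *)

theory Defs
  imports "HOL-Analysis.Analysis"
begin

definition isometric_isomorphism ::
  "('a::real_normed_vector \<Rightarrow> 'b::real_normed_vector) \<Rightarrow> bool" where
  "isometric_isomorphism \<Phi> \<longleftrightarrow> linear \<Phi> \<and> bij \<Phi> \<and> (\<forall>x. norm (\<Phi> x) = norm x)"

text \<open>Functionals with values in \<open>\<real> \<union> {+\<infinity>}\<close> are modelled as \<^typ>\<open>ereal\<close>-valued functions;
  the value \<open>-\<infinity>\<close> is excluded by properness.\<close>

definition eff_dom :: "('u \<Rightarrow> ereal) \<Rightarrow> 'u set" where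
  "eff_dom J = {u. J u < \<infinity>}"

definition proper :: "('u \<Rightarrow> ereal) \<Rightarrow> bool" where
  "proper J \<longleftrightarrow> (\<forall>u. J u \<noteq> -\<infinity>) \<and> eff_dom J \<noteq> {}"

definition convex_functional :: "('u::real_vector \<Rightarrow> ereal) \<Rightarrow> bool" where
  "convex_functional J \<longleftrightarrow>
     (\<forall>u v. \<forall>t\<in>{0..1}. J ((1 - t) *\<^sub>R u + t *\<^sub>R v) \<le> ereal (1 - t) * J u + ereal t * J v)"

text \<open>Multiplication on \<^typ>\<open>ereal\<close> satisfies \<open>0 * \<infinity> = 0\<close>.\<close>

definition one_homogeneous :: "('u::real_vector \<Rightarrow> ereal) \<Rightarrow> bool" where
  "one_homogeneous J \<longleftrightarrow> (\<forall>c u. J (c *\<^sub>R u) = ereal \<bar>c\<bar> * J u)"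

text \<open>If \<open>J\<close> is proper and \<open>J u = \<infinity>\<close>, the set below is empty (take \<open>v\<close> in the effective domain),
  so the convention \<open>\<infinity> - \<infinity> = \<infinity>\<close> on \<^typ>\<open>ereal\<close> does no harm.\<close>

definition subdifferential ::
  "('u::real_normed_vector \<Rightarrow> ereal) \<Rightarrow> 'u \<Rightarrow> ('u \<Rightarrow>\<^sub>L real) set" where
  "subdifferential J u = {p. \<forall>v. 0 \<le> J v - J u - ereal (blinfun_apply p (v - u))}"

text \<open>The Hilbert space is identified with its dual through the inner product.\<close>

definition dual_adjoint ::
  "('u::real_normed_vector \<Rightarrow>\<^sub>L 'h::real_inner) \<Rightarrow> 'h \<Rightarrow> ('u \<Rightarrow>\<^sub>L real)" where
  "dual_adjoint K h = blinfun_inner_left h o\<^sub>L K"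

lemma dual_adjoint_apply:
  "blinfun_apply (dual_adjoint K h) u = inner h (blinfun_apply K u)"
  by (simp add: dual_adjoint_def inner_commute)

definition singular_vector ::
  "('u::real_normed_vector \<Rightarrow>\<^sub>L 'h::real_inner) \<Rightarrow> ('u \<Rightarrow> ereal) \<Rightarrow> real \<Rightarrow> 'u \<Rightarrow> bool" where
  "singular_vector K J lam u \<longleftrightarrow>
     u \<noteq> 0 \<and> norm (blinfun_apply K u) = 1 \<and>
     lam *\<^sub>R dual_adjoint K (blinfun_apply K u) \<in> subdifferential J u"

definition jump_time :: "(real \<Rightarrow> 'a::topological_space) \<Rightarrow> real \<Rightarrow> bool" where
  "jump_time u t \<longleftrightarrow> (\<exists>l r. (u \<longlongrightarrow> l) (at_left t) \<and> (u \<longlongrightarrow> r) (at_right t) \<and> l \<noteq> r)"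

text \<open>Only the values of \<open>u\<close> and \<open>p\<close> on \<open>[0, \<infinity>)\<close> matter. Continuity and the time derivative of
  \<open>p\<close> refer to the operator norm of the dual space.\<close>

definition iss_flow_solution ::
  "('u::real_normed_vector \<Rightarrow>\<^sub>L 'h::real_inner) \<Rightarrow> ('u \<Rightarrow> ereal) \<Rightarrow> 'h \<Rightarrow> (real \<Rightarrow> 'u) \<Rightarrow> bool" where
  "iss_flow_solution K J f u \<longleftrightarrow>
     (\<exists>p :: real \<Rightarrow> ('u \<Rightarrow>\<^sub>L real).
        continuous_on {0..} p \<and> p 0 = 0 \<and>
        (\<forall>t\<ge>0. p t \<in> subdifferential J (u t)) \<and>
        (\<forall>t>0. \<not> jump_time u t \<longrightarrow>
           (p has_vector_derivative dual_adjoint K (f - blinfun_apply K (u t))) (at t)))"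

end

theory Submission
  imports Defs
begin

text \<open>With \<open>q = K\<^sup>* K u\<^sub>\<lambda>\<close>, the dual path is \<open>p(t) = min(\<gamma> t, \<lambda>) q\<close>. For a one-homogeneous \<open>J\<close>,
  \<open>p \<in> \<partial>J(u)\<close> holds iff \<open>J u = \<langle>p, u\<rangle>\<close> and \<open>p\<close> is dominated by \<open>J\<close>. Hence \<open>\<lambda> = J u\<^sub>\<lambda> \<ge> 0\<close>, all
  multiples \<open>s q\<close> with \<open>0 \<le> s \<le> \<lambda>\<close> lie in \<open>\<partial>J(0)\<close>, and \<open>\<lambda> q\<close> lies in \<open>\<partial>J(\<gamma> u\<^sub>\<lambda>)\<close>.\<close>

lemma one_homogeneous_zero:
  assumes "one_homogeneous J"
  shows "J 0 = 0"
proof -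
  have "J (0 *\<^sub>R 0) = ereal \<bar>0\<bar> * J 0"
    using assms unfolding one_homogeneous_def by blast
  then show ?thesis
    by (simp add: zero_ereal_def[symmetric])
qed

text \<open>Testing the subgradient inequality at \<open>0\<close> and at
  \<open>2 *\<^sub>R u\<close> bounds \<open>p u\<close> from both sides by \<open>J u\<close>. Once
  \<open>J u = p u\<close>, these terms cancel and only domination by \<open>J\<close> remains, a
  condition independent of \<open>u\<close>.\<close>

lemma subdifferential_one_homogeneous_iff:
  assumes "proper J" and hom: "one_homogeneous J"
  shows "p \<in> subdifferential J u \<longleftrightarrow>
    J u = ereal (blinfun_apply p u) \<and> (\<forall>v. ereal (blinfun_apply p v) \<le> J v)"
    (is "_ \<longleftrightarrow> ?R")
proof
  assume "p \<in> subdifferential J u"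
  then have sub: "0 \<le> J v - J u - ereal (p (v - u))" for v
    unfolding subdifferential_def by blast
  have J0: "J 0 = 0"
    using hom by (rule one_homogeneous_zero)
  have "J u \<noteq> -\<infinity>"
    using \<open>proper J\<close> unfolding proper_def by blast
  \<comment> \<open>An infinite \<open>J u\<close> would make the inequality at \<open>v = 0\<close>
    read \<open>0 \<le> -\<infinity>\<close>.\<close>
  moreover have "J u \<noteq> \<infinity>"
    using sub[of 0] J0 by auto
  ultimately obtain j where j: "J u = ereal j"
    by (cases "J u") auto
  have "J (2 *\<^sub>R u) = ereal (2 * j)"
    using hom j unfolding one_homogeneous_def by simp
  then have "p u \<le> j"
    using sub[of "2 *\<^sub>R u"] j by (simp add: blinfun.bilinear_simps)
  moreover have "j \<le> p u"
    using sub[of 0] j J0 by (simp add: blinfun.bilinear_simps zero_ereal_def)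
  ultimately have pu: "j = p u"
    by simp
  have "ereal (p v) \<le> J v" for v
    using sub[of v] j pu by (cases "J v") (auto simp: blinfun.bilinear_simps)
  with j pu show ?R
    by simp
next
  assume ?R
  then have ju: "J u = ereal (p u)" and le: "\<And>v. ereal (p v) \<le> J v"
    by auto
  have "0 \<le> J v - J u - ereal (p (v - u))" for v
    using le[of v] ju by (cases "J v") (auto simp: blinfun.bilinear_simps)
  then show "p \<in> subdifferential J u"
    unfolding subdifferential_def by blast
qed

text \<open>This exempts the switching time from the flow equation. Both one-sided filters omit
  \<open>c\<close>, so the value there does not affect the limits.\<close>

lemma jump_time_step:
  fixes a b :: "'a::t2_space"
  assumes "a \<noteq> b"
  shows "jump_time (\<lambda>t. if t < c then a else b) c"
proof -
  have "\<forall>\<^sub>F t in at_left c. (if t < c then a else b) = a"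
    by (simp add: eventually_at_filter)
  then have "((\<lambda>t. if t < c then a else b) \<longlongrightarrow> a) (at_left c)"
    by (rule tendsto_eventually)
  moreover have "\<forall>\<^sub>F t in at_right c. (if t < c then a else b) = b"
    by (simp add: eventually_at_filter)
  then have "((\<lambda>t. if t < c then a else b) \<longlongrightarrow> b) (at_right c)"
    by (rule tendsto_eventually)
  ultimately show ?thesis
    using assms unfolding jump_time_def by blast
qed

theorem theorem9:
  fixes \<Phi> :: "'u::banach \<Rightarrow> ('x::banach \<Rightarrow>\<^sub>L real)"
    and K :: "'u \<Rightarrow>\<^sub>L 'h::{real_inner, complete_space}"
    and J :: "'u \<Rightarrow> ereal"
    and u_lam :: 'u and lam \<gamma> :: real and f :: 'h
  assumes dual: "isometric_isomorphism \<Phi>"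
    and proper: "proper J"
    and convex: "convex_functional J"
    and nonneg: "\<forall>u. J u \<ge> 0"
    and subdiff: "\<forall>u\<in>eff_dom J. subdifferential J u \<noteq> {}"
    and homogeneous: "one_homogeneous J"
    and singular: "singular_vector K J lam u_lam"
    and gamma: "\<gamma> > 0"
    and data: "f = \<gamma> *\<^sub>R blinfun_apply K u_lam"
  shows "iss_flow_solution K J f (\<lambda>t. if t < lam / \<gamma> then 0 else \<gamma> *\<^sub>R u_lam)"
proof -
  define q where "q = dual_adjoint K (K u_lam)"
  \<comment> \<open>This integrates the flow: the slope is \<open>\<gamma> *\<^sub>R q\<close> while
    \<open>u = 0\<close>, and zero once \<open>K u = f\<close>. The two pieces meet at
    \<open>lam / \<gamma>\<close>.\<close>
  define p where "p t = min (\<gamma> * t) lam *\<^sub>R q" for t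
  note subdiff_iff = subdifferential_one_homogeneous_iff[OF proper homogeneous]
  have nz: "u_lam \<noteq> 0" and q_sub: "lam *\<^sub>R q \<in> subdifferential J u_lam" and "q u_lam = 1"
    using singular unfolding singular_vector_def q_def
    by (auto simp: dual_adjoint_apply dot_square_norm)
  then have Ju: "J u_lam = ereal lam" and q_le: "\<And>v. ereal (lam * q v) \<le> J v"
    by (auto simp: subdiff_iff scaleR_blinfun.rep_eq)
  have lam: "0 \<le> lam"
    using nonneg[rule_format, of u_lam] Ju by simp
  have sub_0: "s *\<^sub>R q \<in> subdifferential J 0" if "0 \<le> s" "s \<le> lam" for s
  proof -
    have "ereal (s * q v) \<le> J v" for v
    \<comment> \<open>Where \<open>q v\<close> is nonnegative, shrinking \<open>lam\<close> to
      \<open>s\<close> only lowers the left side; elsewhere that side is nonpositive and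
      \<open>J\<close> is not.\<close>
    proof (cases "0 \<le> q v")
      case True
      then have "ereal (s * q v) \<le> ereal (lam * q v)"
        using that by (simp add: mult_right_mono)
      then show ?thesis
        using q_le[of v] by order
    next
      case False
      then have "ereal (s * q v) \<le> 0"
        using that by (simp add: mult_nonneg_nonpos)
      then show ?thesis
        using nonneg[rule_format, of v] by order
    qed
    then show ?thesis
      by (simp add: subdiff_iff one_homogeneous_zero[OF homogeneous] scaleR_blinfun.rep_eq)
  qed
  \<comment> \<open>Domination carries over from \<open>u_lam\<close>, so only the equality must be
    rescaled by \<open>\<gamma>\<close>.\<close>
  have "J (\<gamma> *\<^sub>R u_lam) = ereal (\<gamma> * lam)"
    using homogeneous gamma Ju unfolding one_homogeneous_def by simp
  then have sub_u: "lam *\<^sub>R q \<in> subdifferential J (\<gamma> *\<^sub>R u_lam)"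
    using q_le \<open>q u_lam = 1\<close> by (simp add: subdiff_iff scaleR_blinfun.rep_eq blinfun.scaleR_right)
  have adj: "dual_adjoint K f = \<gamma> *\<^sub>R q"
    unfolding q_def data by (rule blinfun_eqI) (simp add: dual_adjoint_apply scaleR_blinfun.rep_eq)
  have less_iff: "t < lam / \<gamma> \<longleftrightarrow> \<gamma> * t < lam" for t
    using gamma by (simp add: field_simps)
  let ?u = "\<lambda>t. if t < lam / \<gamma> then 0 else \<gamma> *\<^sub>R u_lam"
  have "continuous_on {0..} p"
    unfolding p_def by (intro continuous_intros)
  \<comment> \<open>The sign of \<open>lam\<close> matters here: a negative value would be the
    minimum at time 0.\<close>
  moreover have "p 0 = 0"
    using lam by (simp add: p_def)
  moreover have "p t \<in> subdifferential J (?u t)" if "0 \<le> t" for t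
    using that gamma sub_0[of "\<gamma> * t"] sub_u by (auto simp: p_def less_iff min_def)
  moreover have "(p has_vector_derivative dual_adjoint K (f - K (?u t))) (at t)"
    if "\<not> jump_time ?u t" for t
  proof -
    have "t \<noteq> lam / \<gamma>"
      using that jump_time_step[of 0 "\<gamma> *\<^sub>R u_lam" "lam / \<gamma>"] nz gamma by auto
    then consider "t < lam / \<gamma>" | "lam / \<gamma> < t"
      by linarith
    then show ?thesis
    proof cases
      case 1
      have "((\<lambda>t. (\<gamma> * t) *\<^sub>R q) has_vector_derivative \<gamma> *\<^sub>R q) (at t)"
        by (auto intro!: derivative_eq_intros)
      \<comment> \<open>The derivative is local, so agreement on an open ray containing
        \<open>t\<close> suffices.\<close>
      moreover have "p s = (\<gamma> * s) *\<^sub>R q" if "s \<in> {..<lam / \<gamma>}" for s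
        using that by (simp add: p_def less_iff)
      ultimately have "(p has_vector_derivative \<gamma> *\<^sub>R q) (at t)"
        using 1 by - (rule has_vector_derivative_transform_within_open
            [of "\<lambda>t. (\<gamma> * t) *\<^sub>R q" _ _ "{..<lam / \<gamma>}"], auto)
      with 1 show ?thesis
        by (simp add: adj)
    next
      case 2
      have "p s = lam *\<^sub>R q" if "s \<in> {lam / \<gamma><..}" for s
        using that less_iff[of s] by (simp add: p_def min_def)
      then have "(p has_vector_derivative 0) (at t)"
        using 2 by - (rule has_vector_derivative_transform_within_open
            [of "\<lambda>_. lam *\<^sub>R q" _ _ "{lam / \<gamma><..}"], auto)
      \<comment> \<open>After the jump the residual vanishes, since
        \<open>f = K (\<gamma> *\<^sub>R u_lam)\<close>.\<close>
      moreover have "dual_adjoint K (f - K (?u t)) = 0"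
        using 2 by (intro blinfun_eqI) (simp add: dual_adjoint_apply data blinfun.scaleR_right)
      ultimately show ?thesis
        by simp
    qed
  qed
  ultimately show ?thesis
    unfolding iss_flow_solution_def by blast
qed

end
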